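(* Let $p\le n$ be positive integers, let $G\in\mathbb{H}^{n\times n}$ be Hermitian positive definite, and let $\mathrm{St}_G(p,\mathbb{H}^n)=\{X\in\mathbb{H}^{n\times p}\mid X^HGX=I_p\}$. Define a map $R^G:T\mathrm{St}_G(p,\mathbb{H}^n)\to\mathrm{St}_G(p,\mathbb{H}^n)$ by $$R^G_X(\eta)=\sqrt{G}^{-1}\,\mathrm{qf}\big(\sqrt{G}(X+\eta)\big)$$ for $X\in\mathrm{St}_G(p,\mathbb{H}^n)$ and $\eta\in T_X\mathrm{St}_G(p,\mathbb{H}^n)$. Then $R^G$ is a retraction on $\mathrm{St}_G(p,\mathbb{H}^n)$.
   Context: $\mathbb{H}$ denotes the quaternions $q=q_0+q_1i+q_2j+q_3k$ with conjugate $\bar q=q_0-q_1i-q_2j-q_3k$; for a quaternionic matrix $A$, $A^H=\bar A^{\top}$ is the conjugate transpose. $G\in\mathbb{H}^{n\times n}$ is Hermitian positive definite if $G^H=G$ and $x^HGx>0$ for every nonzero $x\in\mathbb{H}^n$; $\sqrt{G}$ is its unique Hermitian positive definite square root ($\sqrt{G}^2=G$). $\mathbb{H}^{n\times p}$ is regarded as a real vector space of dimension $4np$ via $A_0+A_1i+A_2j+A_3k\mapsto(A_0,A_1,A_2,A_3)\in(\mathbb{R}^{n\times p})^4$, and $\mathrm{St}_G(p,\mathbb{H}^n)$ is regarded as a real embedded submanifold of it, whose tangent space at $X$ is $T_X\mathrm{St}_G(p,\mathbb{H}^n)=\{\xi\in\mathbb{H}^{n\times p}\mid\xi^HGX+X^HG\xi=0\}$;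 $T\mathrm{St}_G(p,\mathbb{H}^n)$ is the tangent bundle. A matrix $A\in\mathbb{H}^{n\times p}$ has full right column rank if, for $x\in\mathbb{H}^p$, $Ax=0$ implies $x=0$. For such $A$, $\mathrm{qf}(A)$ denotes the Q-factor of its QR decomposition $A=QR$, where $Q\in\mathbb{H}^{n\times p}$ satisfies $Q^HQ=I_p$ and $R\in\mathbb{H}^{p\times p}$ is upper triangular, normalized so that $R$ has positive real diagonal entries. For $X\in\mathrm{St}_G(p,\mathbb{H}^n)$ and $\eta\in T_X\mathrm{St}_G(p,\mathbb{H}^n)$, the matrix $\sqrt{G}(X+\eta)$ has full right column rank, so its QR decomposition is unique. A retraction on a manifold $\mathcal{M}$ is a smooth map $R:T\mathcal{M}\to\mathcal{M}$ such that, writing $R_X$ for the restriction of $R$ to $T_X\mathcal{M}$, one has $R_X(0)=X$ and $\mathrm{D}R_X(0)=\mathrm{id}_{T_X\mathcal{M}}$ for every $X\in\mathcal{M}$. *)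

theory Defs
  imports "HOL-Analysis.Analysis"
begin

section \<open>Quaternions\<close>

codatatype quat = Quat (q0: real) (q1: real) (q2: real) (q3: real)

lemma quat_eqI [intro?]:
  "q0 x = q0 y \<Longrightarrow> q1 x = q1 y \<Longrightarrow> q2 x = q2 y \<Longrightarrow> q3 x = q3 y \<Longrightarrow> x = y"
  by (rule quat.expand) simp

lemma quat_eq_iff: "x = y \<longleftrightarrow> q0 x = q0 y \<and> q1 x = q1 y \<and> q2 x = q2 y \<and> q3 x = q3 y"
  by (auto intro: quat_eqI)

primcorec qi :: quat where
  "q0 qi = 0" | "q1 qi = 1" | "q2 qi = 0" | "q3 qi = 0"

primcorec qj :: quat where
  "q0 qj = 0" | "q1 qj = 0" | "q2 qj = 1" | "q3 qj = 0"

primcorec qk :: quat where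
  "q0 qk = 0" | "q1 qk = 0" | "q2 qk = 0" | "q3 qk = 1"

primcorec qcnj :: "quat \<Rightarrow> quat" where
  "q0 (qcnj x) = q0 x"
| "q1 (qcnj x) = - q1 x"
| "q2 (qcnj x) = - q2 x"
| "q3 (qcnj x) = - q3 x"

instantiation quat :: ab_group_add
begin

primcorec zero_quat where
  "q0 0 = 0" | "q1 0 = 0" | "q2 0 = 0" | "q3 0 = 0"

primcorec plus_quat where
  "q0 (x + y) = q0 x + q0 y"
| "q1 (x + y) = q1 x + q1 y"
| "q2 (x + y) = q2 x + q2 y"
| "q3 (x + y) = q3 x + q3 y"

primcorec uminus_quat where
  "q0 (- x) = - q0 x"
| "q1 (- x) = - q1 x"
| "q2 (- x) = - q2 x"
| "q3 (- x) = - q3 x"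

primcorec minus_quat where
  "q0 (x - y) = q0 x - q0 y"
| "q1 (x - y) = q1 x - q1 y"
| "q2 (x - y) = q2 x - q2 y"
| "q3 (x - y) = q3 x - q3 y"

instance
  by standard (simp_all add: quat_eq_iff)

end

instantiation quat :: ring_1
begin

primcorec one_quat where
  "q0 1 = 1" | "q1 1 = 0" | "q2 1 = 0" | "q3 1 = 0"

primcorec times_quat where
  "q0 (x * y) = q0 x * q0 y - q1 x * q1 y - q2 x * q2 y - q3 x * q3 y"
| "q1 (x * y) = q0 x * q1 y + q1 x * q0 y + q2 x * q3 y - q3 x * q2 y"
| "q2 (x * y) = q0 x * q2 y - q1 x * q3 y + q2 x * q0 y + q3 x * q1 y"
| "q3 (x * y) = q0 x * q3 y + q1 x * q2 y - q2 x * q1 y + q3 x * q0 y"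

instance
  by standard (simp_all add: quat_eq_iff algebra_simps)

end

lemma quat_units_mult:
  "qi * qi = - 1" "qj * qj = - 1" "qk * qk = - 1"
  "qi * qj = qk" "qj * qk = qi" "qk * qi = qj"
  "qj * qi = - qk" "qk * qj = - qi" "qi * qk = - qj"
  by (simp_all add: quat_eq_iff)

instantiation quat :: real_algebra_1
begin

primcorec scaleR_quat where
  "q0 (scaleR r x) = r * q0 x"
| "q1 (scaleR r x) = r * q1 x"
| "q2 (scaleR r x) = r * q2 x"
| "q3 (scaleR r x) = r * q3 x"

instance
  by standard (simp_all add: quat_eq_iff algebra_simps)

end

lemma quat_eq_units:
  "x = of_real (q0 x) + q1 x *\<^sub>R qi + q2 x *\<^sub>R qj + q3 x *\<^sub>R qk"
  by (simp add: quat_eq_iff of_real_def)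

instantiation quat :: real_div_algebra
begin

definition inverse_quat :: "quat \<Rightarrow> quat" where
  "inverse_quat x = qcnj x /\<^sub>R ((q0 x)\<^sup>2 + (q1 x)\<^sup>2 + (q2 x)\<^sup>2 + (q3 x)\<^sup>2)"

definition divide_quat :: "quat \<Rightarrow> quat \<Rightarrow> quat" where
  "divide_quat x y = x * inverse y"

instance
proof
  fix x y :: quat
  show "inverse (0::quat) = 0"
    by (simp add: inverse_quat_def quat_eq_iff)
  show "x div y = x * inverse y"
    by (simp add: divide_quat_def)
  define N where "N = (q0 x)\<^sup>2 + (q1 x)\<^sup>2 + (q2 x)\<^sup>2 + (q3 x)\<^sup>2"
  assume "x \<noteq> 0"
  then have nz: "N \<noteq> 0"
    by (auto simp: N_def quat_eq_iff add_nonneg_eq_0_iff)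
  have l: "qcnj x * x = N *\<^sub>R 1" and r: "x * qcnj x = N *\<^sub>R 1"
    by (simp_all add: quat_eq_iff N_def power2_eq_square)
  have inv: "inverse x = qcnj x /\<^sub>R N"
    by (simp add: inverse_quat_def N_def)
  show "inverse x * x = 1"
    using nz by (simp add: inv l)
  show "x * inverse x = 1"
    using nz by (simp add: inv r)
qed

end

instantiation quat :: real_normed_div_algebra
begin

definition norm_quat :: "quat \<Rightarrow> real" where
  "norm_quat x = sqrt ((q0 x)\<^sup>2 + (q1 x)\<^sup>2 + (q2 x)\<^sup>2 + (q3 x)\<^sup>2)"

definition sgn_quat :: "quat \<Rightarrow> quat" where
  "sgn_quat x = x /\<^sub>R norm x"

definition dist_quat :: "quat \<Rightarrow> quat \<Rightarrow> real" where
  "dist_quat x y = norm (x - y)"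

definition uniformity_quat :: "(quat \<times> quat) filter" where
  [code del]: "uniformity_quat = (INF e\<in>{0 <..}. principal {(x, y). dist x y < e})"

definition open_quat :: "quat set \<Rightarrow> bool" where
  [code del]: "open_quat U \<longleftrightarrow> (\<forall>x\<in>U. eventually (\<lambda>(x', y). x' = x \<longrightarrow> y \<in> U) uniformity)"

instance
proof
  fix r :: real and x y :: quat and U :: "quat set"
  show "(norm x = 0) = (x = 0)"
    by (auto simp: norm_quat_def quat_eq_iff add_nonneg_eq_0_iff)
  show "norm (scaleR r x) = \<bar>r\<bar> * norm x"
    by (simp add: norm_quat_def power_mult_distrib distrib_left [symmetric] real_sqrt_mult)
  show "norm (x * y) = norm x * norm y"
    unfolding norm_quat_def real_sqrt_mult [symmetric]
    by (rule arg_cong [where f = sqrt]) (simp add: power2_eq_square algebra_simps)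
  have "norm (x + y)
      = norm (((q0 x, q1 x), (q2 x, q3 x)) + ((q0 y, q1 y), (q2 y, q3 y)))"
    by (simp add: norm_quat_def norm_Pair add.assoc)
  also have "\<dots> \<le> norm ((q0 x, q1 x), (q2 x, q3 x)) + norm ((q0 y, q1 y), (q2 y, q3 y))"
    by (rule norm_triangle_ineq)
  also have "\<dots> = norm x + norm y"
    by (simp add: norm_quat_def norm_Pair add.assoc)
  finally show "norm (x + y) \<le> norm x + norm y" .
qed (simp_all add: sgn_quat_def dist_quat_def uniformity_quat_def open_quat_def)

end

instantiation quat :: real_inner
begin

definition inner_quat :: "quat \<Rightarrow> quat \<Rightarrow> real" where
  "inner_quat x y = q0 x * q0 y + q1 x * q1 y + q2 x * q2 y + q3 x * q3 y"

instance
proof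
  fix r :: real and x y z :: quat
  show "inner x y = inner y x"
    by (simp add: inner_quat_def mult.commute)
  show "inner (x + y) z = inner x z + inner y z"
    by (simp add: inner_quat_def distrib_right)
  show "inner (scaleR r x) y = r * inner x y"
    by (simp add: inner_quat_def distrib_left mult.assoc)
  show "0 \<le> inner x x"
    by (simp add: inner_quat_def)
  show "(inner x x = 0) = (x = 0)"
    by (auto simp: inner_quat_def quat_eq_iff add_nonneg_eq_0_iff)
  show "norm x = sqrt (inner x x)"
    by (simp add: inner_quat_def norm_quat_def power2_eq_square)
qed

end

instantiation quat :: euclidean_space
begin

definition Basis_quat :: "quat set" where
  "Basis_quat = {1, qi, qj, qk}"

instance
proof
  fix x u v :: quat
  show "finite (Basis :: quat set)" "(Basis :: quat set) \<noteq> {}"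
    by (simp_all add: Basis_quat_def)
  show "(\<forall>u\<in>Basis. inner x u = 0) \<longleftrightarrow> x = 0"
    by (simp add: Basis_quat_def inner_quat_def) (simp add: quat_eq_iff)
  assume "u \<in> Basis" "v \<in> Basis"
  then show "inner u v = (if u = v then 1 else 0)"
    unfolding Basis_quat_def by (elim insertE emptyE) (simp_all add: inner_quat_def quat_eq_iff)
qed

end

lemma DIM_quat [simp]: "DIM(quat) = 4"
  by (simp add: Basis_quat_def card_insert_if quat_eq_iff)


section \<open>Quaternionic matrices\<close>

definition conj_transpose :: "quat^'p^'n \<Rightarrow> quat^'n^'p" where
  "conj_transpose A = (\<chi> i j. qcnj (A $ j $ i))"

text \<open>
  Positivity of the quaternion \<open>x\<^sup>H G x\<close> means that it is real and positive.
\<close>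
definition hermitian_pos_def :: "quat^'n^'n \<Rightarrow> bool" where
  "hermitian_pos_def G \<longleftrightarrow>
     conj_transpose G = G \<and>
     (\<forall>x. x \<noteq> 0 \<longrightarrow> (\<exists>r>0. (\<Sum>i\<in>UNIV. qcnj (x $ i) * (G *v x) $ i) = of_real r))"

definition matrix_sqrt :: "quat^'n^'n \<Rightarrow> quat^'n^'n" where
  "matrix_sqrt G = (THE S. hermitian_pos_def S \<and> S ** S = G)"

text \<open>
  The columns are indexed by an arbitrary finite linearly ordered type, which is what
  upper triangularity refers to.
\<close>
definition is_qr ::
  "quat^('p::{finite,linorder})^'n \<Rightarrow> quat^('p::{finite,linorder})^'n \<Rightarrow>
   quat^('p::{finite,linorder})^('p::{finite,linorder}) \<Rightarrow> bool" where
  "is_qr A Q R \<longleftrightarrow>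
     A = Q ** R \<and>
     conj_transpose Q ** Q = mat 1 \<and>
     (\<forall>i j. j < i \<longrightarrow> R $ i $ j = 0) \<and>
     (\<forall>i. \<exists>r>0. R $ i $ i = of_real r)"

text \<open>
  The factorisation is unique when \<open>A\<close> has full right column rank; otherwise
  \<open>qf A\<close> is unspecified.
\<close>
definition qf :: "quat^('p::{finite,linorder})^'n \<Rightarrow> quat^('p::{finite,linorder})^'n" where
  "qf A = (THE Q. \<exists>R. is_qr A Q R)"


section \<open>Smooth maps and retractions\<close>

text \<open>
  \<open>C_k_on k U f\<close>: on the open set \<open>U\<close> of a Euclidean space, \<open>f\<close> is \<open>k\<close> times continuously
  differentiable. The successor clause asks all directional derivatives of \<open>f\<close> to be of class
  \<open>C\<^sup>k\<close>; in finite dimension this is the same as asking it of the total derivative.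
\<close>
primrec C_k_on ::
  "nat \<Rightarrow> 'a::euclidean_space set \<Rightarrow> ('a \<Rightarrow> 'b::euclidean_space) \<Rightarrow> bool" where
  "C_k_on 0 U f \<longleftrightarrow> continuous_on U f"
| "C_k_on (Suc k) U f \<longleftrightarrow>
     (\<forall>x\<in>U. f differentiable (at x)) \<and>
     (\<forall>v. C_k_on k U (\<lambda>x. frechet_derivative f (at x) v))"

definition smooth_on_open ::
  "'a::euclidean_space set \<Rightarrow> ('a \<Rightarrow> 'b::euclidean_space) \<Rightarrow> bool" where
  "smooth_on_open U f \<longleftrightarrow> open U \<and> (\<forall>k. C_k_on k U f)"

text \<open>
  A map defined on an embedded submanifold \<open>S\<close> of a Euclidean space is smooth iff near every
  point of \<open>S\<close> it is the restriction of a smooth map on an open set of the ambient space. If its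
  values lie in an embedded submanifold of the target space, this is also smoothness as a map
  into that submanifold.
\<close>
definition smooth_map_on ::
  "'a::euclidean_space set \<Rightarrow> ('a \<Rightarrow> 'b::euclidean_space) \<Rightarrow> bool" where
  "smooth_map_on S f \<longleftrightarrow>
     (\<forall>x\<in>S. \<exists>U g. x \<in> U \<and> smooth_on_open U g \<and> (\<forall>y\<in>S \<inter> U. f y = g y))"

text \<open>
  \<open>M\<close> is an embedded submanifold with tangent spaces \<open>T X\<close>, so that \<open>Sigma M T\<close> is its
  tangent bundle. The derivative of \<open>R X\<close> at \<open>0\<close> is taken within the linear subspace \<open>T X\<close>;
  only the values of \<open>R X\<close> on \<open>T X\<close> matter.
\<close>
definition manifold_retraction ::
  "'a::euclidean_space set \<Rightarrow> ('a \<Rightarrow> 'a set) \<Rightarrow> ('a \<Rightarrow> 'a \<Rightarrow> 'a) \<Rightarrow> bool" where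
  "manifold_retraction M T R \<longleftrightarrow>
     (\<forall>X\<in>M. \<forall>\<eta>\<in>T X. R X \<eta> \<in> M) \<and>
     smooth_map_on (Sigma M T) (\<lambda>(X, \<eta>). R X \<eta>) \<and>
     (\<forall>X\<in>M. R X 0 = X \<and> (R X has_derivative (\<lambda>\<xi>. \<xi>)) (at 0 within T X))"


section \<open>The generalised Stiefel manifold\<close>

definition stiefel :: "quat^'n^'n \<Rightarrow> (quat^'p^'n) set" where
  "stiefel G = {X. conj_transpose X ** G ** X = mat 1}"

definition stiefel_tangent :: "quat^'n^'n \<Rightarrow> quat^'p^'n \<Rightarrow> (quat^'p^'n) set" where
  "stiefel_tangent G X =
     {\<xi>. conj_transpose \<xi> ** G ** X + conj_transpose X ** G ** \<xi> = 0}"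

definition qr_retraction ::
  "quat^'n^'n \<Rightarrow> quat^('p::{finite,linorder})^'n \<Rightarrow>
   quat^('p::{finite,linorder})^'n \<Rightarrow> quat^('p::{finite,linorder})^'n" where
  "qr_retraction G X \<eta> = matrix_inv (matrix_sqrt G) ** qf (matrix_sqrt G ** (X + \<eta>))"

end

theory Submission
  imports Defs
begin

text \<open>
  Write \<open>S = sqrt G\<close>. The substitution \<open>Y = S X\<close> turns \<open>X\<^sup>H G X\<close> into \<open>Y\<^sup>H Y\<close>, so that it carries
  the generalised Stiefel manifold to the ordinary one and the map to \<open>qf (Y + \<theta>)\<close> with
  \<open>\<theta> = S \<eta>\<close>. For this to make sense \<open>S\<close> has to exist uniquely. Existence is a contraction
  argument: after scaling, \<open>t G = I - E\<close> with \<open>norm E < 1\<close>, and \<open>I - Y\<close> is a square root of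
  \<open>I - E\<close> exactly when \<open>Y = (E + Y\<^sup>2) / 2\<close>, which has a fixed point among the small
  self-adjoint quaternion-linear operators (\<open>hermitian_pos_def_sqrt_exists\<close>). For uniqueness,
  the difference \<open>D\<close> of two roots \<open>S\<close>, \<open>T\<close> satisfies \<open>S D + D T = 0\<close>, and pairing this with \<open>D\<close>
  in the Frobenius inner product gives a sum of nonnegative terms that vanishes only if \<open>D = 0\<close>
  (\<open>hermitian_pos_def_sqrt_unique\<close>).

  The Q-factor is computed by the Gram--Schmidt process: comparing columns in \<open>A = Q R\<close> forces
  the columns of \<open>Q\<close> to obey the Gram--Schmidt recursion (\<open>is_qr_unique\<close>), and conversely the
  recursion produces a decomposition when no residual vanishes, that is, when the columns are
  right linearly independent (\<open>is_qr_exists\<close>). Every step of the recursion is built from bilinear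
  maps and from the normalisation of a nonzero vector, hence it is smooth
  (\<open>smooth_near_gram_schmidt\<close>). Full rank of \<open>S (X + \<eta>)\<close> holds on the whole tangent bundle
  because its Gram matrix is \<open>I + (S \<eta>)\<^sup>H (S \<eta>)\<close>.

  The derivative at \<open>0\<close> also follows the recursion (\<open>has_derivative_gram_schmidt\<close>). At an
  orthonormal family the projection coefficients \<open>q\<^sub>i\<^sup>H a\<^sub>j\<close> with \<open>i < j\<close> vanish, and the tangency condition
  says that their derivatives vanish too, as do the derivatives of the norms. To first order
  the process therefore leaves tangent perturbations untouched, and its derivative on the
  tangent space is the identity.
\<close>

section \<open>Right quaternionic vector spaces\<close>

lemma qcnj_simps [simp]:
  "qcnj (x + y) = qcnj x + qcnj y" "qcnj (x - y) = qcnj x - qcnj y" "qcnj (- x) = - qcnj x"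
  "qcnj (x * y) = qcnj y * qcnj x" "qcnj (qcnj x) = x" "qcnj 0 = 0" "qcnj 1 = 1"
  "qcnj (r *\<^sub>R x) = r *\<^sub>R qcnj x" "qcnj (of_real r) = of_real r"
  by (simp_all add: quat_eq_iff of_real_def)

lemma qcnj_sum: "qcnj (\<Sum>i\<in>A. f i) = (\<Sum>i\<in>A. qcnj (f i))"
  by (induction A rule: infinite_finite_induct) simp_all

lemma q0_sum: "q0 (\<Sum>i\<in>A. f i) = (\<Sum>i\<in>A. q0 (f i))"
  by (induction A rule: infinite_finite_induct) simp_all

lemma qcnj_fixed_imp_real: "qcnj x = x \<Longrightarrow> x = of_real (q0 x)"
  by (simp add: quat_eq_iff of_real_def)

lemma q0_of_real [simp]: "q0 (of_real r) = r"
  by (simp add: of_real_def)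

lemma of_real_quat_commute: "of_real r * (x :: quat) = x * of_real r"
  by (simp add: of_real_def)

text \<open>
  The conjugation sits on the left argument and scalars act from the right, so that matrices,
  which multiply from the left, commute with the scalars. The component \<open>q0\<close> of the quaternionic
  form is the real inner product; this is the bridge to real analysis on the underlying
  Euclidean space.
\<close>
definition qdot :: "quat^'n \<Rightarrow> quat^'n \<Rightarrow> quat" where
  "qdot x y = (\<Sum>i\<in>UNIV. qcnj (x $ i) * y $ i)"

definition rscale :: "quat^'n \<Rightarrow> quat \<Rightarrow> quat^'n" where
  "rscale x q = (\<chi> i. x $ i * q)"

lemma rscale_nth [simp]: "rscale x q $ i = x $ i * q"
  by (simp add: rscale_def)

lemma qdot_add_left: "qdot (x + y) z = qdot x z + qdot y z"
  and qdot_add_right: "qdot x (y + z) = qdot x y + qdot x z"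
  and qdot_diff_right: "qdot x (y - z) = qdot x y - qdot x z"
  and qdot_scaleR_left: "qdot (r *\<^sub>R x) z = r *\<^sub>R qdot x z"
  and qdot_scaleR_right: "qdot x (r *\<^sub>R z) = r *\<^sub>R qdot x z"
  and qdot_zero_right [simp]: "qdot z 0 = 0"
  by (simp_all add: qdot_def algebra_simps sum.distrib sum_subtractf scaleR_sum_right)

lemma qdot_rscale_right: "qdot x (rscale y q) = qdot x y * q"
  by (simp add: qdot_def sum_distrib_right mult.assoc)

lemma qdot_rscale_left: "qdot (rscale x q) y = qcnj q * qdot x y"
  by (simp add: qdot_def sum_distrib_left mult.assoc)

lemma qcnj_qdot: "qcnj (qdot x y) = qdot y x"
  by (simp add: qdot_def qcnj_sum)

lemma qdot_sum_right: "qdot x (\<Sum>i\<in>A. f i) = (\<Sum>i\<in>A. qdot x (f i))"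
  by (induction A rule: infinite_finite_induct) (simp_all add: qdot_add_right)

lemma q0_qdot: "q0 (qdot x y) = x \<bullet> y"
  by (simp add: qdot_def q0_sum inner_vec_def inner_quat_def)

lemma qdot_self: "qdot x x = of_real (x \<bullet> x)"
  using qcnj_fixed_imp_real[OF qcnj_qdot[of x x]] by (simp add: q0_qdot)

text \<open>
  The norm is multiplicative because the real number \<open>qdot x x\<close> is central.
\<close>
lemma norm_rscale: "norm (rscale x q) = norm x * norm q"
proof -
  have "qdot (rscale x q) (rscale x q) = qcnj q * (qdot x x * q)"
    by (simp only: qdot_rscale_left qdot_rscale_right mult.assoc)
  then have "norm (rscale x q) ^ 2 = q0 (qcnj q * (qdot x x * q))"
    by (metis q0_qdot power2_norm_eq_inner)
  also have "qcnj q * (qdot x x * q) = of_real (x \<bullet> x) * (qcnj q * q)"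
    by (simp add: qdot_self mult.assoc of_real_quat_commute)
  also have "qcnj q * q = of_real (norm q ^ 2)"
    by (simp add: quat_eq_iff norm_quat_def power2_eq_square of_real_def)
  also have "q0 (of_real (x \<bullet> x) * of_real (norm q ^ 2)) = (norm x * norm q) ^ 2"
    by (simp add: power_mult_distrib power2_norm_eq_inner flip: of_real_mult of_real_power)
  finally show ?thesis
    by (simp add: power2_eq_iff_nonneg)
qed

lemma rscale_add_left: "rscale (x + y) q = rscale x q + rscale y q"
  and rscale_add_right: "rscale x (p + q) = rscale x p + rscale x q"
  and rscale_diff_left: "rscale (x - y) q = rscale x q - rscale y q"
  and rscale_scaleR_left: "rscale (r *\<^sub>R x) q = r *\<^sub>R rscale x q"
  and rscale_scaleR_right: "rscale x (r *\<^sub>R q) = r *\<^sub>R rscale x q"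
  and rscale_zero_left [simp]: "rscale 0 q = 0"
  and rscale_zero_right [simp]: "rscale x 0 = 0"
  and rscale_of_real: "rscale x (of_real r) = r *\<^sub>R x"
  by (simp_all add: vec_eq_iff algebra_simps of_real_def)

lemma bounded_bilinear_rscale: "bounded_bilinear rscale"
  by (rule bounded_bilinear.intro)
     (auto simp: rscale_add_left rscale_add_right rscale_scaleR_left rscale_scaleR_right
        norm_rscale intro!: exI[of _ 1])

lemma bilinear_qdot: "bilinear qdot"
  by (auto simp: bilinear_def linear_iff qdot_add_left qdot_add_right qdot_scaleR_left
        qdot_scaleR_right)

lemma bounded_bilinear_qdot: "bounded_bilinear qdot"
  using bilinear_qdot by (simp add: bilinear_conv_bounded_bilinear)

section \<open>Matrices acting on the right vector space\<close>

lemma conj_transpose_nth [simp]: "conj_transpose A $ i $ j = qcnj (A $ j $ i)"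
  by (simp add: conj_transpose_def)

lemma conj_transpose_mult: "conj_transpose (A ** B) = conj_transpose B ** conj_transpose A"
  by (simp add: vec_eq_iff matrix_matrix_mult_def qcnj_sum)

lemma conj_transpose_add: "conj_transpose (A + B) = conj_transpose A + conj_transpose B"
  by (simp add: vec_eq_iff)

lemma conj_transpose_diff: "conj_transpose (A - B) = conj_transpose A - conj_transpose B"
  by (simp add: vec_eq_iff)

lemma conj_transpose_idem [simp]: "conj_transpose (conj_transpose A) = A"
  by (simp add: vec_eq_iff)

lemma qdot_matrix_vector: "qdot x (A *v y) = qdot (conj_transpose A *v x) y"
proof -
  have "qdot x (A *v y) = (\<Sum>i\<in>UNIV. \<Sum>j\<in>UNIV. qcnj (x $ i) * A $ i $ j * y $ j)"
    by (simp add: qdot_def matrix_vector_mult_def sum_distrib_left mult.assoc)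
  also have "\<dots> = (\<Sum>j\<in>UNIV. \<Sum>i\<in>UNIV. qcnj (x $ i) * A $ i $ j * y $ j)"
    by (rule sum.swap)
  also have "\<dots> = qdot (conj_transpose A *v x) y"
    by (simp add: qdot_def matrix_vector_mult_def sum_distrib_right qcnj_sum)
  finally show ?thesis .
qed

text \<open>
  Hence the conjugate transpose is also the adjoint for the real inner product, and a Hermitian
  matrix acts as a real self-adjoint operator.
\<close>
lemma inner_matrix_vector: "x \<bullet> (A *v y) = (conj_transpose A *v x) \<bullet> y"
  by (simp add: qdot_matrix_vector flip: q0_qdot)

lemma matrix_vector_rscale: "A *v rscale x q = rscale (A *v x) q"
  by (simp add: vec_eq_iff matrix_vector_mult_def sum_distrib_right mult.assoc)

lemma linear_matrix_vector_quat: "linear (\<lambda>x. (A :: quat^'m^'n) *v x)"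
  by (rule linearI) (simp_all add: vec_eq_iff matrix_vector_mult_def algebra_simps sum.distrib
      scaleR_sum_right)

lemma linear_matrix_mult_quat: "linear (\<lambda>X. (A :: quat^'m^'n) ** (X :: quat^'p^'m))"
  by (rule linearI) (simp_all add: vec_eq_iff matrix_matrix_mult_def algebra_simps sum.distrib
      scaleR_sum_right)

lemma column_matrix_mult: "column j (A ** B) = A *v column j B"
  by (simp add: vec_eq_iff column_def matrix_matrix_mult_def matrix_vector_mult_def)

lemma column_nth [simp]: "column j A $ i = A $ i $ j"
  by (simp add: column_def)

lemma matrix_eq_columns: "A = B \<longleftrightarrow> (\<forall>j. column j A = column j B)"
  by (auto simp: vec_eq_iff)

lemma conj_transpose_mult_nth: "(conj_transpose A ** B) $ i $ j = qdot (column i A) (column j B)"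
  by (simp add: matrix_matrix_mult_def qdot_def)

lemma matrix_vector_mult_columns: "A *v x = (\<Sum>i\<in>UNIV. rscale (column i A) (x $ i))"
  by (simp add: vec_eq_iff matrix_vector_mult_def)

lemma inner_matrix_columns: "(A :: quat^'p^'n) \<bullet> B = (\<Sum>j\<in>UNIV. column j A \<bullet> column j B)"
  unfolding inner_vec_def by (simp add: inner_vec_def) (rule sum.swap)

lemma inner_conj_transpose: "(conj_transpose A :: quat^'p^'n) \<bullet> conj_transpose B = A \<bullet> B"
proof -
  have "qcnj x \<bullet> qcnj y = x \<bullet> y" for x y
    by (simp add: inner_quat_def)
  then show ?thesis
    unfolding inner_vec_def by (simp add: inner_vec_def) (rule sum.swap)
qed

text \<open>
  Square roots are found as operators; this lemma turns them back into matrices, the columns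
  being the images of the unit vectors.
\<close>
lemma right_linear_is_matrix:
  fixes f :: "quat^'m \<Rightarrow> quat^'n"
  assumes add: "\<And>x y. f (x + y) = f x + f y" and sc: "\<And>x q. f (rscale x q) = rscale (f x) q"
  obtains M where "\<And>x. f x = M *v x"
proof
  fix x :: "quat^'m"
  have zero: "f 0 = 0"
    using add[of 0 0] by simp
  have sum: "f (\<Sum>i\<in>A. g i) = (\<Sum>i\<in>A. f (g i))" for A :: "'m set" and g
    by (induction A rule: infinite_finite_induct) (simp_all add: add zero)
  have "x = (\<Sum>j\<in>UNIV. rscale (axis j 1) (x $ j))"
    by (simp add: vec_eq_iff axis_def if_distrib[of "\<lambda>t. t * _"] cong: if_cong)
  then have "f x = f (\<Sum>j\<in>UNIV. rscale (axis j 1) (x $ j))"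
    by simp
  also have "\<dots> = (\<Sum>j\<in>UNIV. rscale (f (axis j 1)) (x $ j))"
    by (simp add: sum sc)
  also have "\<dots> = (\<chi> i j. f (axis j 1) $ i) *v x"
    by (simp add: vec_eq_iff matrix_vector_mult_def)
  finally show "f x = (\<chi> i j. f (axis j 1) $ i) *v x" .
qed

section \<open>Hermitian positive definite matrices and their square roots\<close>

text \<open>
  For a Hermitian matrix the quaternion \<open>x\<^sup>H S x\<close> equals its own conjugate, so it is real and
  only the sign of the real inner product matters.
\<close>
lemma hermitian_pos_def_iff:
  "hermitian_pos_def S \<longleftrightarrow> conj_transpose S = S \<and> (\<forall>x. x \<noteq> 0 \<longrightarrow> 0 < x \<bullet> (S *v x))"
proof (cases "conj_transpose S = S")
  case True
  have "(\<exists>r>0. qdot x (S *v x) = of_real r) \<longleftrightarrow> 0 < x \<bullet> (S *v x)" for x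
  proof -
    have "qcnj (qdot x (S *v x)) = qdot x (S *v x)"
      by (simp add: qcnj_qdot) (simp add: qdot_matrix_vector True)
    then have "qdot x (S *v x) = of_real (x \<bullet> (S *v x))"
      using qcnj_fixed_imp_real by (metis q0_qdot)
    then show ?thesis
      by (auto simp del: of_real_eq_iff dest: arg_cong[of _ _ q0])
  qed
  then show ?thesis
    unfolding hermitian_pos_def_def qdot_def[symmetric] by (simp add: True)
qed (simp add: hermitian_pos_def_def)

text \<open>
  Injectivity gives surjectivity by counting real dimensions, and a right inverse is then
  assembled from preimages of the unit vectors.
\<close>
lemma hermitian_pos_def_invertible:
  fixes S :: "quat^'n^'n"
  assumes "hermitian_pos_def S"
  shows "invertible S"
proof -
  have inj: "x = 0" if "S *v x = 0" for x
    using assms that by (force simp: hermitian_pos_def_iff)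
  have "inj (\<lambda>x. S *v x)"
    using inj linear_injective_0[OF linear_matrix_vector_quat[of S]] by auto
  then have "surj (\<lambda>x. S *v x)"
    using linear_injective_imp_surjective[OF linear_matrix_vector_quat[of S]] by auto
  then have "\<forall>j. \<exists>t. axis j 1 = S *v t"
    by (meson surjD)
  then obtain t where t: "\<And>j. S *v t j = axis j 1"
    by metis
  define T where "T = (\<chi> i j. t j $ i)"
  have ST: "S ** T = mat 1"
  proof -
    have "column j (S ** T) = column j (mat 1)" for j
    proof -
      have "column j T = t j"
        by (simp add: vec_eq_iff T_def)
      then show ?thesis
        by (simp add: column_matrix_mult t) (simp add: vec_eq_iff axis_def mat_def)
    qed
    then show ?thesis
      by (simp add: matrix_eq_columns)
  qed
  have "T ** S = mat 1"
  proof (subst matrix_eq, intro allI)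
    fix x
    \<comment> \<open>A right inverse of an injective matrix is a left inverse as well.\<close>
    have "S *v ((T ** S) *v x - x) = 0"
      by (simp add: matrix_vector_mult_diff_distrib matrix_vector_mul_assoc matrix_mul_assoc ST)
    then show "(T ** S) *v x = mat 1 *v x"
      using inj by force
  qed
  with ST show ?thesis
    by (auto simp: invertible_def)
qed

lemma matrix_inv_mult:
  assumes "invertible A"
  shows "A ** matrix_inv A = mat 1" "matrix_inv A ** A = mat 1"
  using someI_ex[OF assms[unfolded invertible_def]] by (simp_all add: matrix_inv_def)

text \<open>
  With \<open>D = S - T\<close> one has \<open>S D + D T = S\<^sup>2 - T\<^sup>2 = 0\<close>. Since \<open>D\<close> and \<open>T\<close> are Hermitian, the pairings
  of \<open>D\<close> with \<open>D T\<close> and with \<open>T D\<close> agree, so that the pairing of \<open>D\<close> with \<open>S D + D T\<close> is a sum of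
  values of the two positive forms at the columns of \<open>D\<close>.
\<close>
lemma hermitian_pos_def_sqrt_unique:
  fixes S T :: "quat^'n^'n"
  assumes S: "hermitian_pos_def S" and T: "hermitian_pos_def T" and eq: "S ** S = T ** T"
  shows "S = T"
proof -
  define D where "D = S - T"
  have hS: "conj_transpose S = S" and hT: "conj_transpose T = T"
    using S T by (auto simp: hermitian_pos_def_iff)
  have hD: "conj_transpose D = D"
    by (simp add: D_def conj_transpose_diff hS hT)
  have "S ** D + D ** T = 0"
    unfolding D_def matrix_eq
    by (simp add: algebra_simps flip: matrix_vector_mul_assoc)
       (simp add: matrix_vector_mul_assoc eq)
  then have "0 = D \<bullet> (S ** D) + D \<bullet> (D ** T)"
    by (metis inner_add_right inner_zero_right)
  also have "D \<bullet> (D ** T) = D \<bullet> (T ** D)"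
    using inner_conj_transpose[of D "D ** T"] by (simp add: conj_transpose_mult hD hT)
  also have "D \<bullet> (S ** D) + D \<bullet> (T ** D) =
      (\<Sum>j\<in>UNIV. column j D \<bullet> (S *v column j D) + column j D \<bullet> (T *v column j D))"
    by (simp add: inner_matrix_columns column_matrix_mult sum.distrib)
  finally have sum0: "(\<Sum>j\<in>UNIV. column j D \<bullet> (S *v column j D) + column j D \<bullet> (T *v column j D)) = 0"
    by simp
  have pos: "0 < x \<bullet> (S *v x) + x \<bullet> (T *v x)" if "x \<noteq> 0" for x
    using S T that by (simp add: hermitian_pos_def_iff add_pos_pos)
  have nonneg: "0 \<le> x \<bullet> (S *v x) + x \<bullet> (T *v x)" for x
    using pos[of x] by (cases "x = 0") auto
  have "column j D \<bullet> (S *v column j D) + column j D \<bullet> (T *v column j D) = 0" for j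
    using sum_nonneg_eq_0_iff[THEN iffD1, OF _ _ sum0] nonneg by auto
  then have "column j D = 0" for j
    using pos[of "column j D"] by force
  then show ?thesis
    by (auto simp: D_def vec_eq_iff)
qed

text \<open>
  The form is bounded below by \<open>c (norm x)\<^sup>2\<close> on the compact unit sphere, and \<open>f\<close> is bounded
  above by \<open>K\<close>. Expanding the square gives
  \<open>(norm (x - t f x))\<^sup>2 \<le> (1 - 2 t c + t\<^sup>2 K\<^sup>2) (norm x)\<^sup>2\<close>, and \<open>t = c / K\<^sup>2\<close> minimises the factor.
\<close>
lemma coercive_contraction:
  fixes f :: "'a::euclidean_space \<Rightarrow> 'a"
  assumes lin: "linear f" and pos: "\<And>x. x \<noteq> 0 \<Longrightarrow> 0 < x \<bullet> f x"
  obtains t \<epsilon> where "0 < t" "0 \<le> \<epsilon>" "\<epsilon> < 1" "\<And>x. norm (x - t *\<^sub>R f x) \<le> \<epsilon> * norm x"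
proof -
  obtain K where K: "K > 0" "\<And>x. norm (f x) \<le> K * norm x"
    using linear_bounded_pos[OF lin] by blast
  have cont: "continuous_on A f" for A
    using lin by (simp add: linear_continuous_on linear_conv_bounded_linear)
  have "\<exists>u\<in>sphere 0 1. \<forall>y\<in>sphere 0 1. u \<bullet> f u \<le> y \<bullet> f (y::'a)"
    by (intro continuous_attains_inf) (auto intro!: continuous_intros cont)
  then obtain u where u: "norm u = 1" "\<And>y. norm y = 1 \<Longrightarrow> u \<bullet> f u \<le> y \<bullet> f y"
    by auto
  define c where "c = u \<bullet> f u"
  have c: "0 < c"
    using pos[of u] u(1) by (force simp: c_def)
  have lower: "c * (norm x)\<^sup>2 \<le> x \<bullet> f x" for x
  proof (cases "x = 0")
    case False
    then have "c \<le> sgn x \<bullet> f (sgn x)"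
      using u(2)[of "sgn x"] by (simp add: c_def norm_sgn)
    also have "\<dots> = (x \<bullet> f x) / (norm x)\<^sup>2"
      by (simp add: sgn_div_norm linear_cmul[OF lin] power2_eq_square field_simps)
    finally show ?thesis
      using False by (simp add: field_simps)
  qed (use linear_0[OF lin] in simp)
  have cK: "c \<le> K"
  proof -
    have "c \<le> norm u * norm (f u)"
      unfolding c_def by (rule norm_cauchy_schwarz)
    also have "\<dots> \<le> K"
      using K(2)[of u] u(1) by simp
    finally show ?thesis .
  qed
  define t where "t = c / K\<^sup>2"
  define \<epsilon> where "\<epsilon> = sqrt (1 - c\<^sup>2 / K\<^sup>2)"
  have q: "0 \<le> 1 - c\<^sup>2 / K\<^sup>2" "1 - c\<^sup>2 / K\<^sup>2 < 1"
    using c cK K(1) by (simp_all add: field_simps power_mono)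
  have "norm (x - t *\<^sub>R f x) \<le> \<epsilon> * norm x" for x
  proof -
    have "(norm (x - t *\<^sub>R f x))\<^sup>2 = (norm x)\<^sup>2 - 2 * t * (x \<bullet> f x) + t\<^sup>2 * (norm (f x))\<^sup>2"
      unfolding power2_norm_eq_inner inner_diff_left inner_diff_right inner_scaleR_left
        inner_scaleR_right inner_commute[of "f x" x] power2_eq_square[of t]
      by (simp add: algebra_simps)
    also have "\<dots> \<le> (norm x)\<^sup>2 - 2 * t * (c * (norm x)\<^sup>2) + t\<^sup>2 * (K * norm x)\<^sup>2"
      using lower[of x] K(2)[of x] c K(1)
      by (intro add_mono diff_mono mult_left_mono power_mono) (auto simp: t_def)
    also have "\<dots> = (1 - c\<^sup>2 / K\<^sup>2) * (norm x)\<^sup>2"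
      using K(1) by (simp add: t_def field_simps power2_eq_square)
    also have "\<dots> = (\<epsilon> * norm x)\<^sup>2"
      using q by (simp add: \<epsilon>_def power_mult_distrib)
    finally show ?thesis
      by (rule power2_le_imp_le) (use q in \<open>auto simp: \<epsilon>_def\<close>)
  qed
  moreover have "0 < t" "0 \<le> \<epsilon>" "\<epsilon> < 1"
    using c K(1) q by (auto simp: t_def \<epsilon>_def real_less_lsqrt)
  ultimately show ?thesis
    using that by blast
qed

text \<open>
  The fixed point of \<open>Y \<mapsto> (E + Y\<^sup>2) / 2\<close> gives \<open>(I - Y)\<^sup>2 = I - E = t G\<close>. The iteration runs in
  the closed set of operators of norm at most \<open>\<epsilon>\<close> that are self-adjoint and commute with right
  multiplication by quaternions, so the fixed point inherits these properties: the first two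
  make \<open>I - Y\<close> positive definite, the third makes it a quaternionic matrix.
\<close>
lemma hermitian_pos_def_sqrt_exists:
  fixes G :: "quat^'n^'n"
  assumes G: "hermitian_pos_def G"
  obtains S where "hermitian_pos_def S" "S ** S = G"
proof -
  have hG: "conj_transpose G = G" and posG: "\<And>x. x \<noteq> 0 \<Longrightarrow> 0 < x \<bullet> (G *v x)"
    using G by (auto simp: hermitian_pos_def_iff)
  obtain t \<epsilon> where t: "0 < t" and \<epsilon>: "0 \<le> \<epsilon>" "\<epsilon> < 1"
    and le: "\<And>x. norm (x - t *\<^sub>R (G *v x)) \<le> \<epsilon> * norm x"
    using coercive_contraction[OF linear_matrix_vector_quat[of G] posG] by blast
  define E :: "(quat^'n) \<Rightarrow>\<^sub>L (quat^'n)" where "E = Blinfun (\<lambda>x. x - t *\<^sub>R (G *v x))"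
  have E: "blinfun_apply E x = x - t *\<^sub>R (G *v x)" for x
    unfolding E_def using linear_matrix_vector_quat[of G]
    by (subst bounded_linear_Blinfun_apply)
       (auto intro!: bounded_linear_intros simp: linear_conv_bounded_linear)
  have normE: "norm E \<le> \<epsilon>"
    using le by (intro norm_blinfun_bound) (auto simp: E \<epsilon>)
  define W :: "((quat^'n) \<Rightarrow>\<^sub>L (quat^'n)) set" where
    "W = {Y. norm Y \<le> \<epsilon>} \<inter> {Y. \<forall>x y. blinfun_apply Y x \<bullet> y = x \<bullet> blinfun_apply Y y}
       \<inter> {Y. \<forall>x q. blinfun_apply Y (rscale x q) = rscale (blinfun_apply Y x) q}"
  define F where "F = (\<lambda>Y. (1/2) *\<^sub>R (E + (Y o\<^sub>L Y)))"
  have F: "blinfun_apply (F Y) x = (1/2) *\<^sub>R (blinfun_apply E x + blinfun_apply Y (blinfun_apply Y x))" for Y x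
    by (simp add: F_def blinfun.bilinear_simps)
  have "closed W"
    unfolding W_def
    by (intro closed_Int closed_Collect_le closed_Collect_all closed_Collect_eq continuous_intros
        bounded_bilinear.continuous_on[OF bounded_bilinear_rscale])
  then have compl: "complete W"
    by (simp add: complete_eq_closed)
  have ne: "W \<noteq> {}"
  proof -
    have "0 \<in> W" using \<epsilon> by (auto simp: W_def)
    then show ?thesis by blast
  qed
  have into: "F ` W \<subseteq> W"
  proof (intro image_subsetI)
    fix Y assume Y: "Y \<in> W"
    have "norm (F Y) \<le> (1/2) * (norm E + norm Y * norm Y)"
      unfolding F_def norm_scaleR
      using norm_triangle_ineq[of E "Y o\<^sub>L Y"] norm_blinfun_compose[of Y Y] by auto
    also have "\<dots> \<le> (1/2) * (\<epsilon> + 1 * \<epsilon>)"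
      using Y \<epsilon> normE by (intro mult_left_mono add_mono mult_mono) (auto simp: W_def)
    finally have "norm (F Y) \<le> \<epsilon>" by simp
    moreover have "blinfun_apply E x \<bullet> y = x \<bullet> blinfun_apply E y" for x y
      by (simp add: E inner_diff_left inner_diff_right inner_matrix_vector hG)
    then have "blinfun_apply (F Y) x \<bullet> y = x \<bullet> blinfun_apply (F Y) y" for x y
      using Y by (simp add: F W_def inner_add_left inner_add_right)
    moreover have "blinfun_apply (F Y) (rscale x q) = rscale (blinfun_apply (F Y) x) q" for x q
      using Y by (simp add: F W_def E rscale_scaleR_left rscale_add_left rscale_diff_left
          matrix_vector_rscale)
    ultimately show "F Y \<in> W" by (simp add: W_def)
  qed
  \<comment> \<open>The identity \<open>Y\<^sup>2 - Z\<^sup>2 = Y (Y - Z) + (Y - Z) Z\<close> respects the order of the factors.\<close>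
  have lip: "dist (F Y) (F Z) \<le> \<epsilon> * dist Y Z" if "Y \<in> W" "Z \<in> W" for Y Z
  proof -
    have "F Y - F Z = (1/2) *\<^sub>R ((Y o\<^sub>L (Y - Z)) + ((Y - Z) o\<^sub>L Z))"
      by (rule blinfun_eqI) (simp add: F blinfun.bilinear_simps algebra_simps)
    then have "norm (F Y - F Z) \<le> (1/2) * (norm (Y o\<^sub>L (Y - Z)) + norm ((Y - Z) o\<^sub>L Z))"
      using norm_triangle_ineq by auto
    also have "\<dots> \<le> (1/2) * (norm Y * norm (Y - Z) + norm (Y - Z) * norm Z)"
      by (intro mult_left_mono add_mono norm_blinfun_compose) auto
    also have "\<dots> \<le> (1/2) * (\<epsilon> * norm (Y - Z) + norm (Y - Z) * \<epsilon>)"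
      using that by (intro mult_left_mono add_mono mult_mono) (auto simp: W_def \<epsilon>)
    finally show ?thesis by (simp add: dist_norm)
  qed
  obtain Y where Y: "Y \<in> W" "F Y = Y"
    using Banach_fix[OF compl ne \<epsilon> into] lip by metis
  define s where "s = (\<lambda>x. (1 / sqrt t) *\<^sub>R (x - blinfun_apply Y x))"
  have "s (x + y) = s x + s y" for x y
    by (simp add: s_def blinfun.bilinear_simps algebra_simps)
  moreover have "s (rscale x q) = rscale (s x) q" for x q
    using Y(1) by (simp add: s_def W_def rscale_scaleR_left rscale_diff_left)
  ultimately obtain S where S: "\<And>x. s x = S *v x"
    using right_linear_is_matrix[of s] by blast
  have fix2: "blinfun_apply Y (blinfun_apply Y x) = 2 *\<^sub>R blinfun_apply Y x - blinfun_apply E x" for x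
  proof -
    have "blinfun_apply Y x = (1/2) *\<^sub>R (blinfun_apply E x + blinfun_apply Y (blinfun_apply Y x))"
      using F[of Y x] Y(2) by simp
    then have "2 *\<^sub>R blinfun_apply Y x = 2 *\<^sub>R ((1/2) *\<^sub>R (blinfun_apply E x + blinfun_apply Y (blinfun_apply Y x)))"
      by (rule arg_cong)
    then show ?thesis by (simp add: algebra_simps)
  qed
  have "S ** S = G"
  proof (subst matrix_eq, intro allI)
    fix x
    have "(S ** S) *v x = s (s x)"
      by (simp add: S matrix_vector_mul_assoc)
    also have "\<dots> = (1 / t) *\<^sub>R (x - 2 *\<^sub>R blinfun_apply Y x + blinfun_apply Y (blinfun_apply Y x))"
      using t by (simp add: s_def blinfun.bilinear_simps algebra_simps scaleR_2)
    also have "\<dots> = G *v x"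
      using t by (simp add: fix2 E)
    finally show "(S ** S) *v x = G *v x" .
  qed
  moreover have "hermitian_pos_def S"
  proof -
    have "(conj_transpose S *v x) \<bullet> y = (S *v x) \<bullet> y" for x y
      using Y(1) by (simp add: W_def inner_diff_left inner_diff_right flip: inner_matrix_vector S)
         (simp add: W_def s_def inner_diff_left inner_diff_right)
    then have "conj_transpose S = S"
      unfolding matrix_eq by (metis vector_eq_rdot)
    moreover have "0 < x \<bullet> (S *v x)" if "x \<noteq> 0" for x
    proof -
      have "x \<bullet> blinfun_apply Y x \<le> norm x * norm (blinfun_apply Y x)"
        by (rule norm_cauchy_schwarz)
      also have "\<dots> \<le> norm x * (norm Y * norm x)"
        by (intro mult_left_mono norm_blinfun) auto
      also have "\<dots> \<le> norm x * (\<epsilon> * norm x)"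
        using Y(1) by (intro mult_left_mono mult_right_mono) (auto simp: W_def)
      also have "\<dots> < norm x * (1 * norm x)"
        using that \<epsilon> by (intro mult_strict_left_mono mult_strict_right_mono) auto
      finally have "x \<bullet> blinfun_apply Y x < x \<bullet> x"
        by (simp add: dot_square_norm power2_eq_square)
      then show ?thesis
        using t by (simp add: s_def inner_diff_right flip: S)
    qed
    ultimately show ?thesis by (simp add: hermitian_pos_def_iff)
  qed
  ultimately show ?thesis using that by blast
qed

lemma matrix_sqrt:
  assumes "hermitian_pos_def G"
  shows "hermitian_pos_def (matrix_sqrt G)" "matrix_sqrt G ** matrix_sqrt G = G"
proof -
  have "\<exists>!S. hermitian_pos_def S \<and> S ** S = G"
    by (metis assms hermitian_pos_def_sqrt_exists hermitian_pos_def_sqrt_unique)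
  from theI'[OF this] show "hermitian_pos_def (matrix_sqrt G)" "matrix_sqrt G ** matrix_sqrt G = G"
    by (auto simp: matrix_sqrt_def)
qed

section \<open>Calculus of smooth maps\<close>

lemma C_k_on_Suc_imp: "C_k_on (Suc k) U f \<Longrightarrow> C_k_on k U f"
proof (induction k arbitrary: f)
  case 0
  then show ?case
    by (auto simp: continuous_on_eq_continuous_within differentiable_imp_continuous_within
        differentiable_at_withinI)
next
  case (Suc k)
  then show ?case by (metis C_k_on.simps(2))
qed

lemma C_k_on_subset: "C_k_on k U f \<Longrightarrow> V \<subseteq> U \<Longrightarrow> C_k_on k V f"
  by (induction k arbitrary: f) (auto intro: continuous_on_subset)

lemma C_k_on_cong:
  assumes "open U" "\<And>x. x \<in> U \<Longrightarrow> f x = g x" "C_k_on k U f"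
  shows "C_k_on k U g"
  using assms(2,3)
proof (induction k arbitrary: f g)
  case 0
  then show ?case by (simp cong: continuous_on_cong)
next
  case (Suc k)
  have der: "(g has_derivative frechet_derivative f (at x)) (at x)" if "x \<in> U" for x
    using Suc.prems that has_derivative_transform_within_open[OF _ \<open>open U\<close> that, of f _ UNIV g]
    by (auto simp: frechet_derivative_works)
  then have "frechet_derivative f (at x) = frechet_derivative g (at x)" if "x \<in> U" for x
    using frechet_derivative_at that by blast
  then have "C_k_on k U (\<lambda>x. frechet_derivative g (at x) v)" for v
    using Suc.IH[of "\<lambda>x. frechet_derivative f (at x) v"] Suc.prems(2) by simp
  then show ?case
    using der by (auto simp: differentiable_def)
qed

text \<open>
  Derivatives computed by the usual rules agree with the Frechet derivative only on the open
  set itself; this introduction rule hides the passage between the two.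
\<close>
lemma C_k_on_SucI:
  assumes "open U" "\<And>x. x \<in> U \<Longrightarrow> (f has_derivative f' x) (at x)"
    "\<And>v. C_k_on k U (\<lambda>x. f' x v)"
  shows "C_k_on (Suc k) U f"
proof -
  have "C_k_on k U (\<lambda>x. frechet_derivative f (at x) v)" for v
    by (rule C_k_on_cong[OF assms(1) _ assms(3)])
       (use frechet_derivative_at[OF assms(2)] in auto)
  then show ?thesis
    using assms(2) by (auto simp: differentiable_def)
qed

lemma C_k_on_SucD:
  assumes "C_k_on (Suc k) U f" "x \<in> U"
  shows "(f has_derivative frechet_derivative f (at x)) (at x)"
  using assms by (simp add: frechet_derivative_works)

lemma C_k_on_const: "C_k_on k U (\<lambda>x. c)"
  by (induction k arbitrary: c) simp_all

lemma C_k_on_bounded_linear: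
  assumes "open U" "bounded_linear f"
  shows "C_k_on k U f"
proof (cases k)
  case 0
  then show ?thesis
    using assms(2) by (simp add: linear_continuous_on)
next
  case (Suc m)
  show ?thesis
    unfolding Suc
    by (rule C_k_on_SucI[OF assms(1) bounded_linear_imp_has_derivative[OF assms(2)]])
       (rule C_k_on_const)
qed

lemma C_k_on_add:
  assumes "open U" "C_k_on k U f" "C_k_on k U g"
  shows "C_k_on k U (\<lambda>x. f x + g x)"
  using assms(2,3)
proof (induction k arbitrary: f g)
  case 0
  then show ?case by (auto intro: continuous_intros)
next
  case (Suc k)
  show ?case
    by (rule C_k_on_SucI[OF assms(1) has_derivative_add
          [OF C_k_on_SucD[OF Suc.prems(1)] C_k_on_SucD[OF Suc.prems(2)]]])
       (use Suc in auto)
qed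

lemma C_k_on_bilinear:
  assumes "open U" "bounded_bilinear h" "C_k_on k U f" "C_k_on k U g"
  shows "C_k_on k U (\<lambda>x. h (f x) (g x))"
  using assms(3,4)
proof (induction k arbitrary: f g)
  case 0
  then show ?case using bounded_bilinear.continuous_on[OF assms(2)] by auto
next
  case (Suc k)
  show ?case
  proof (rule C_k_on_SucI[OF assms(1)])
    show "((\<lambda>x. h (f x) (g x)) has_derivative (\<lambda>v. h (f x) (frechet_derivative g (at x) v) +
        h (frechet_derivative f (at x) v) (g x))) (at x)" if "x \<in> U" for x
      using that Suc.prems by (intro bounded_bilinear.FDERIV[OF assms(2)] C_k_on_SucD)
    show "C_k_on k U (\<lambda>x. h (f x) (frechet_derivative g (at x) v) +
        h (frechet_derivative f (at x) v) (g x))" for v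
      using Suc.prems Suc.prems[THEN C_k_on_Suc_imp]
      by (intro C_k_on_add[OF assms(1)] Suc.IH) simp_all
  qed
qed

text \<open>
  The derivative is polynomial in the function \<open>inverse (norm f)\<close> itself, in \<open>f\<close> and in the
  derivative of \<open>f\<close>. Induction on the order of differentiability therefore closes in
  \<open>C_k_on_inverse_norm\<close> with the product rule alone.
\<close>
lemma has_derivative_inverse_norm:
  fixes f :: "'a::real_normed_vector \<Rightarrow> 'b::real_inner"
  assumes "(f has_derivative f') (at x within T)" "f x \<noteq> 0"
  shows "((\<lambda>x. inverse (norm (f x))) has_derivative
      (\<lambda>v. - (inverse (norm (f x)) ^ 3 * (f x \<bullet> f' v)))) (at x within T)"
proof -
  have "((\<lambda>x. norm (f x)) has_derivative (\<lambda>v. f' v \<bullet> sgn (f x))) (at x within T)"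
    using has_derivative_compose[OF assms(1) has_derivative_norm[OF assms(2)]] by simp
  then have "((\<lambda>x. inverse (norm (f x))) has_derivative
     (\<lambda>v. - (inverse (norm (f x)) * (f' v \<bullet> sgn (f x)) * inverse (norm (f x))))) (at x within T)"
    using assms(2) by (intro Deriv.has_derivative_inverse) simp_all
  then show ?thesis
    by (rule has_derivative_eq_rhs)
       (simp add: fun_eq_iff sgn_div_norm power3_eq_cube inner_commute divide_simps)
qed

lemma C_k_on_inverse_norm:
  assumes "open U" "\<And>x. x \<in> U \<Longrightarrow> f x \<noteq> 0" "C_k_on k U f"
  shows "C_k_on k U (\<lambda>x. inverse (norm (f x)))"
  using assms(3)
proof (induction k)
  case 0
  then show ?case using assms(2) by (auto intro!: continuous_intros)
next
  case (Suc k)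
  define h where "h = (\<lambda>x. inverse (norm (f x)))"
  note times = C_k_on_bilinear[OF assms(1) bounded_bilinear_mult]
  have h: "C_k_on k U h"
    unfolding h_def using Suc C_k_on_Suc_imp by blast
  have "C_k_on k U (\<lambda>x. (- 1) * ((h x * (h x * h x)) *
      (f x \<bullet> frechet_derivative f (at x) v)))" for v
    using Suc.prems C_k_on_Suc_imp[OF Suc.prems]
    by (intro times h C_k_on_const C_k_on_bilinear[OF assms(1) bounded_bilinear_inner]) auto
  then have "C_k_on k U (\<lambda>x. - (h x ^ 3 * (f x \<bullet> frechet_derivative f (at x) v)))" for v
    by (simp add: power3_eq_cube mult.assoc)
  then show ?case
    unfolding h_def
    by (rule C_k_on_SucI[OF assms(1) has_derivative_inverse_norm, rotated -1])
       (use C_k_on_SucD[OF Suc.prems] assms(2) in auto)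
qed

text \<open>
  Smoothness in a neighbourhood that is left unspecified: the domains shrink along a
  construction, and only a given point of the manifold has to survive.
\<close>
definition smooth_near :: "('a::euclidean_space \<Rightarrow> 'b::euclidean_space) \<Rightarrow> 'a \<Rightarrow> bool" where
  "smooth_near f x \<longleftrightarrow> (\<exists>U. x \<in> U \<and> smooth_on_open U f)"

lemma smooth_near_const: "smooth_near (\<lambda>x. c) x"
  unfolding smooth_near_def smooth_on_open_def
  by (intro exI[of _ UNIV]) (simp add: C_k_on_const)

lemma smooth_near_bounded_linear: "bounded_linear f \<Longrightarrow> smooth_near f x"
  unfolding smooth_near_def smooth_on_open_def
  by (intro exI[of _ UNIV]) (simp add: C_k_on_bounded_linear)

lemma smooth_near_bilinear:
  assumes "bounded_bilinear h" "smooth_near f x" "smooth_near g x"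
  shows "smooth_near (\<lambda>x. h (f x) (g x)) x"
proof -
  obtain U V where "x \<in> U \<inter> V" "smooth_on_open U f" "smooth_on_open V g"
    using assms(2,3) by (auto simp: smooth_near_def)
  then show ?thesis
    unfolding smooth_near_def smooth_on_open_def
    by (intro exI[of _ "U \<inter> V"])
       (auto intro!: C_k_on_bilinear[OF _ assms(1)] intro: C_k_on_subset)
qed

lemma smooth_near_add:
  assumes "smooth_near f x" "smooth_near g x"
  shows "smooth_near (\<lambda>x. f x + g x) x"
proof -
  obtain U V where "x \<in> U \<inter> V" "smooth_on_open U f" "smooth_on_open V g"
    using assms by (auto simp: smooth_near_def)
  then show ?thesis
    unfolding smooth_near_def smooth_on_open_def
    by (intro exI[of _ "U \<inter> V"]) (auto intro!: C_k_on_add intro: C_k_on_subset)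
qed

lemma smooth_near_linear_image:
  assumes "bounded_linear L" "smooth_near f x"
  shows "smooth_near (\<lambda>x. L (f x)) x"
proof -
  interpret bounded_linear L by fact
  \<comment> \<open>A linear map is treated as a bilinear one with a constant first argument.\<close>
  have "bounded_bilinear (\<lambda>(r::real) y. r *\<^sub>R L y)"
    using bounded_bilinear.comp[OF bounded_bilinear_scaleR bounded_linear_ident assms(1)] by simp
  from smooth_near_bilinear[OF this smooth_near_const[of 1] assms(2)] show ?thesis by simp
qed

lemma smooth_near_diff:
  "smooth_near f x \<Longrightarrow> smooth_near g x \<Longrightarrow> smooth_near (\<lambda>x. f x - g x) x"
  using smooth_near_add[of f x "\<lambda>x. - g x"]
    smooth_near_linear_image[OF bounded_linear_minus[OF bounded_linear_ident], of g x] by simp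

lemma smooth_near_sum:
  "(\<And>i. i \<in> I \<Longrightarrow> smooth_near (f i) x) \<Longrightarrow> smooth_near (\<lambda>x. \<Sum>i\<in>I. f i x) x"
  by (induction I rule: infinite_finite_induct) (auto intro: smooth_near_const smooth_near_add)

lemma smooth_near_sgn:
  assumes "smooth_near f x" "f x \<noteq> 0"
  shows "smooth_near (\<lambda>x. sgn (f x)) x"
proof -
  obtain U where U: "x \<in> U" "open U" "\<And>k. C_k_on k U f"
    using assms by (auto simp: smooth_near_def smooth_on_open_def)
  define V where "V = U \<inter> f -` (- {0})"
  have V: "open V" "x \<in> V" "V \<subseteq> U" "\<And>y. y \<in> V \<Longrightarrow> f y \<noteq> 0"
    using continuous_open_preimage[of U f "- {0}"] U(1,2) U(3)[of 0] assms(2)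
    by (auto simp: V_def simp flip: C_k_on.simps(1))
  have "C_k_on k V (\<lambda>x. inverse (norm (f x)))" for k
    using V U C_k_on_subset by (intro C_k_on_inverse_norm) blast+
  then have "smooth_near (\<lambda>x. inverse (norm (f x))) x"
    using V unfolding smooth_near_def smooth_on_open_def by blast
  from smooth_near_bilinear[OF bounded_bilinear_scaleR this assms(1)] show ?thesis
    by (simp add: sgn_div_norm divide_inverse)
qed

lemma smooth_map_on_eqI:
  assumes "\<And>x. x \<in> S \<Longrightarrow> smooth_near g x" "\<And>x. x \<in> S \<Longrightarrow> f x = g x"
  shows "smooth_map_on S f"
  using assms unfolding smooth_map_on_def smooth_near_def by blast

text \<open>
  A derivative within a set is determined only on the displacements into the set. Applied to a
  linear subspace \<open>T\<close>, it allows identities that hold for tangent directions only.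
\<close>
lemma has_derivative_cong_within:
  assumes "(f has_derivative D) (at x within T)" "bounded_linear D'"
    "\<And>y. y \<in> T \<Longrightarrow> D (y - x) = D' (y - x)"
  shows "(f has_derivative D') (at x within T)"
  using assms(1,2) unfolding has_derivative_within_alt
  by (simp only: assms(3) cong: ball_cong) blast

section \<open>Gram--Schmidt orthonormalisation and the QR decomposition\<close>

text \<open>
  Well-founded induction along a finite linear order, which need not be an instance of the class
  of well-orders.
\<close>
lemma finite_linorder_induct [case_names less]:
  fixes j :: "'p::{finite,linorder}"
  assumes "\<And>j. (\<And>i. i < j \<Longrightarrow> P i) \<Longrightarrow> P j"
  shows "P j"
proof (induction j rule: measure_induct_rule[of "\<lambda>j. card {..<j}"])
  case (less j)
  have "card {..<i} < card {..<j}" if "i < j" for i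
    using that by (intro psubset_card_mono) auto
  with less assms show ?case by blast
qed

function gram_schmidt :: "('p::{finite,linorder} \<Rightarrow> quat^'n) \<Rightarrow> 'p \<Rightarrow> quat^'n" where
  "gram_schmidt a j = sgn (a j -
     (\<Sum>i\<in>{..<j}. rscale (gram_schmidt a i) (qdot (gram_schmidt a i) (a j))))"
  by auto
termination
  by (relation "Wellfounded.measure (\<lambda>(a, j). card {..<j})") (auto intro!: psubset_card_mono)

declare gram_schmidt.simps [simp del]

text \<open>
  The component of \<open>a j\<close> orthogonal to the earlier vectors, before normalisation.
\<close>
definition residual :: "('p::{finite,linorder} \<Rightarrow> quat^'n) \<Rightarrow> 'p \<Rightarrow> quat^'n" where
  "residual a j =
     a j - (\<Sum>i\<in>{..<j}. rscale (gram_schmidt a i) (qdot (gram_schmidt a i) (a j)))"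

lemma gram_schmidt_residual: "gram_schmidt a j = sgn (residual a j)"
  by (simp add: residual_def gram_schmidt.simps[of a j])

text \<open>
  Each Gram--Schmidt vector is a right combination of the columns up to its own index, so the
  residual at \<open>j\<close> is the column \<open>j\<close> plus a combination of earlier ones. The coefficient \<open>1\<close> at
  position \<open>j\<close> shows that the combination is nontrivial; this is how full rank excludes a zero
  residual.
\<close>
lemma residual_in_span:
  obtains z where "residual (\<lambda>j. column j A) j = A *v z" "z $ j = 1"
proof -
  define a where "a = (\<lambda>j. column j A)"
  have "\<exists>z. residual a j = A *v z \<and> z $ j = 1 \<and> (\<forall>k>j. z $ k = 0)" for j
  proof (induction j rule: finite_linorder_induct)
    case (less j)
    then obtain z where z: "\<And>i. i < j \<Longrightarrow> residual a i = A *v z i"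
      "\<And>i k. i < j \<Longrightarrow> i < k \<Longrightarrow> z i $ k = 0"
      by metis
    define y where "y = (\<lambda>i. inverse (norm (residual a i)) *\<^sub>R z i)"
    have y: "gram_schmidt a i = A *v y i" if "i < j" for i
      using that linear_cmul[OF linear_matrix_vector_quat[of A]]
      by (simp add: gram_schmidt_residual sgn_div_norm divide_inverse y_def z)
    have aj: "a j = A *v axis j 1"
      by (simp add: a_def vec_eq_iff matrix_vector_mult_def axis_def if_distrib[of "\<lambda>t. _ * t"]
          cong: if_cong)
    let ?z = "axis j 1 - (\<Sum>i\<in>{..<j}. rscale (y i) (qdot (gram_schmidt a i) (a j)))"
    have "residual a j = A *v ?z"
      unfolding residual_def
      by (simp add: matrix_vector_mult_diff_distrib linear_sum[OF linear_matrix_vector_quat]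
          matrix_vector_rscale y flip: aj)
    moreover have "?z $ j = 1" "\<forall>k>j. ?z $ k = 0"
      using z(2) by (auto simp: y_def axis_def intro!: sum.neutral)
    ultimately show ?case by blast
  qed
  then show ?thesis
    using that unfolding a_def by blast
qed

lemma residual_nonzero:
  assumes "\<And>x. A *v x = 0 \<Longrightarrow> x = 0"
  shows "residual (\<lambda>j. column j A) j \<noteq> 0"
  using residual_in_span[of A j] assms by (metis zero_index zero_neq_one)

lemma gram_schmidt_orthonormal:
  assumes nz: "\<And>j. residual a j \<noteq> 0"
  shows "qdot (gram_schmidt a i) (gram_schmidt a j) = (if i = j then 1 else 0)"
proof -
  have unit: "qdot (gram_schmidt a j) (gram_schmidt a j) = 1" for j
    using nz[of j] by (simp add: qdot_self gram_schmidt_residual norm_sgn flip: power2_norm_eq_inner)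
  have orth: "\<forall>i<j. qdot (gram_schmidt a i) (gram_schmidt a j) = 0" for j
  proof (induction j rule: finite_linorder_induct)
    case (less j)
    have prev: "qdot (gram_schmidt a i) (gram_schmidt a k) = (if i = k then 1 else 0)"
      if "i < j" "k < j" for i k
      using less[OF that(1)] less[OF that(2)] unit
      by (metis linorder_neqE qcnj_qdot qcnj_simps(6))
    show ?case
    proof (intro allI impI)
      fix i assume i: "i < j"
      have "(\<Sum>k\<in>{..<j}. qdot (gram_schmidt a i) (gram_schmidt a k) * qdot (gram_schmidt a k) (a j))
          = (\<Sum>k\<in>{..<j}. if i = k then qdot (gram_schmidt a k) (a j) else 0)"
        by (rule sum.cong) (auto simp: prev i)
      also have "\<dots> = qdot (gram_schmidt a i) (a j)"
        using i by simp
      finally have "qdot (gram_schmidt a i) (residual a j) = 0"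
        by (simp add: residual_def qdot_diff_right qdot_sum_right qdot_rscale_right)
      then show "qdot (gram_schmidt a i) (gram_schmidt a j) = 0"
        by (simp add: gram_schmidt_residual[of a j] sgn_div_norm qdot_scaleR_right)
    qed
  qed
  show ?thesis
    using orth unit by (metis linorder_neqE qcnj_qdot qcnj_simps(6))
qed

definition orthonormalize :: "quat^('p::{finite,linorder})^'n \<Rightarrow> quat^('p::{finite,linorder})^'n"
  where "orthonormalize A = (\<chi> i j. gram_schmidt (\<lambda>j. column j A) j $ i)"

lemma column_orthonormalize: "column j (orthonormalize A) = gram_schmidt (\<lambda>j. column j A) j"
  by (simp add: vec_eq_iff orthonormalize_def)

lemma column_mult_upper_triangular:
  fixes Q :: "quat^('p::{finite,linorder})^'n"
  assumes "\<And>i. j < i \<Longrightarrow> R $ i $ j = 0"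
  shows "column j (Q ** R) =
    (\<Sum>i\<in>{..<j}. rscale (column i Q) (R $ i $ j)) + rscale (column j Q) (R $ j $ j)"
proof -
  have "column j (Q ** R) = (\<Sum>i\<in>UNIV. rscale (column i Q) (R $ i $ j))"
    by (simp add: column_matrix_mult matrix_vector_mult_columns)
  also have "\<dots> = (\<Sum>i\<in>{..j}. rscale (column i Q) (R $ i $ j))"
  proof (rule sum.mono_neutral_right)
    show "\<forall>i\<in>UNIV - {..j}. rscale (column i Q) (R $ i $ j) = 0"
      using assms by (metis DiffD2 atMost_iff not_le rscale_zero_right)
  qed auto
  also have "{..j} = insert j {..<j}"
    by auto
  finally show ?thesis
    by (simp add: add.commute)
qed

text \<open>
  From \<open>A = Q R\<close> follows \<open>Q\<^sup>H A = R\<close>, so the coefficients are the projection coefficients of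
  Gram--Schmidt. By induction the residual at \<open>j\<close> is \<open>q\<^sub>j\<close> times the diagonal entry of \<open>R\<close>; that
  entry is real and positive, hence normalisation returns \<open>q\<^sub>j\<close>.
\<close>
lemma is_qr_unique:
  assumes "is_qr A Q R"
  shows "Q = orthonormalize A"
proof -
  have A: "A = Q ** R" and QQ: "conj_transpose Q ** Q = mat 1"
    and upper: "\<And>i j. j < i \<Longrightarrow> R $ i $ j = 0" and diag: "\<And>i. \<exists>r>0. R $ i $ i = of_real r"
    using assms by (auto simp: is_qr_def)
  have coeff: "qdot (column i Q) (column j A) = R $ i $ j" for i j
    unfolding conj_transpose_mult_nth[symmetric] A by (simp add: matrix_mul_assoc QQ)
  have unit: "norm (column j Q) = 1" for j
    using arg_cong[OF QQ, of "\<lambda>M. q0 (M $ j $ j)"]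
    by (simp add: conj_transpose_mult_nth q0_qdot mat_def norm_eq_sqrt_inner)
  have "column j Q = gram_schmidt (\<lambda>j. column j A) j" for j
  proof (induction j rule: finite_linorder_induct)
    case (less j)
    obtain r where r: "r > 0" "R $ j $ j = of_real r"
      using diag by blast
    have "residual (\<lambda>j. column j A) j =
        column j A - (\<Sum>i\<in>{..<j}. rscale (column i Q) (R $ i $ j))"
      unfolding residual_def
      by (intro arg_cong2[of _ _ _ _ minus] sum.cong refl) (simp add: less[symmetric] coeff)
    also have "\<dots> = r *\<^sub>R column j Q"
      using column_mult_upper_triangular[of j R Q, folded A] upper r(2)
      by (simp add: rscale_of_real)
    finally have "residual (\<lambda>j. column j A) j = r *\<^sub>R column j Q" .
    then show ?case
      using r(1) by (simp add: gram_schmidt_residual sgn_div_norm unit)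
  qed
  then show ?thesis
    by (simp add: matrix_eq_columns column_orthonormalize)
qed

lemma is_qr_exists:
  assumes "\<And>x. A *v x = 0 \<Longrightarrow> x = 0"
  obtains R where "is_qr A (orthonormalize A) R"
proof
  define a where "a = (\<lambda>j. column j A)"
  have nz: "residual a j \<noteq> 0" for j
    unfolding a_def using assms by (rule residual_nonzero)
  let ?Q = "orthonormalize A"
  define R where "R = (\<chi> i j. if i < j then qdot (gram_schmidt a i) (a j)
     else if i = j then of_real (norm (residual a j)) else 0)"
  have "column j A = column j (?Q ** R)" for j
  proof -
    have "column j (?Q ** R) = (\<Sum>i\<in>{..<j}. rscale (gram_schmidt a i) (qdot (gram_schmidt a i) (a j)))
        + norm (residual a j) *\<^sub>R gram_schmidt a j"
      by (subst column_mult_upper_triangular)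
         (auto simp: R_def column_orthonormalize rscale_of_real simp flip: a_def)
    also have "norm (residual a j) *\<^sub>R gram_schmidt a j = residual a j"
      using nz by (simp add: gram_schmidt_residual sgn_div_norm)
    finally show ?thesis
      by (simp add: residual_def) (simp add: a_def)
  qed
  moreover have "conj_transpose ?Q ** ?Q = mat 1"
    by (simp add: vec_eq_iff conj_transpose_mult_nth column_orthonormalize mat_def
        gram_schmidt_orthonormal[OF nz, unfolded a_def])
  ultimately show "is_qr A ?Q R"
    using nz by (auto simp: is_qr_def matrix_eq_columns R_def)
qed

lemma qf_eq_orthonormalize:
  assumes "\<And>x. A *v x = 0 \<Longrightarrow> x = 0"
  shows "qf A = orthonormalize A"
  unfolding qf_def
proof (rule the_equality)
  show "\<exists>R. is_qr A (orthonormalize A) R"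
    using is_qr_exists[OF assms] by blast
qed (use is_qr_unique in blast)

text \<open>
  The vectors depend on a parameter \<open>z\<close>, so that composition with a smooth family is built into
  the induction.
\<close>
lemma smooth_near_gram_schmidt:
  assumes smooth: "\<And>j. smooth_near (\<lambda>z. a z j) z" and nz: "\<And>j. residual (a z) j \<noteq> 0"
  shows "smooth_near (\<lambda>z. gram_schmidt (a z) j) z"
proof (induction j rule: finite_linorder_induct)
  case (less j)
  have "smooth_near (\<lambda>z. residual (a z) j) z"
    unfolding residual_def
    by (intro smooth_near_diff smooth smooth_near_sum smooth_near_bilinear[OF bounded_bilinear_rscale]
        smooth_near_bilinear[OF bounded_bilinear_qdot] less) auto
  then show ?case
    unfolding gram_schmidt_residual using nz by (rule smooth_near_sgn)
qed

lemma gram_schmidt_fixes_orthonormal: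
  assumes "\<And>i j. qdot (a i) (a j) = (if i = j then 1 else 0)"
  shows "gram_schmidt a j = a j" "residual a j = a j"
proof -
  have unit: "norm (a j) = 1" for j
    using arg_cong[OF assms[of j j], of q0] by (simp add: q0_qdot norm_eq_sqrt_inner)
  have step: "residual a j = a j" if "\<And>i. i < j \<Longrightarrow> gram_schmidt a i = a i" for j
    unfolding residual_def using that by (subst sum.neutral) (auto simp: assms)
  have gs: "gram_schmidt a j = a j" for j
  proof (induction j rule: finite_linorder_induct)
    case (less j)
    then show ?case
      using step[of j] by (simp add: gram_schmidt_residual sgn_div_norm unit)
  qed
  then show "gram_schmidt a j = a j" "residual a j = a j"
    using step by blast+
qed

text \<open>
  By induction on the column. In the residual of \<open>a\<^sub>j\<close> the product rule produces terms with the
  coefficient \<open>q\<^sub>i\<^sup>H a\<^sub>j = 0\<close> and terms with its derivative, which vanishes by tangency; so the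
  residual has the same derivative \<open>b\<^sub>j\<close> as \<open>a\<^sub>j\<close>. Normalisation subtracts the radial part of
  \<open>b\<^sub>j\<close>, which is the real part of the tangency condition for \<open>i = j\<close> and is zero.
\<close>
lemma has_derivative_gram_schmidt:
  fixes a :: "'z::real_normed_vector \<Rightarrow> 'p::{finite,linorder} \<Rightarrow> quat^'n"
  assumes der: "\<And>j. ((\<lambda>z. a z j) has_derivative b j) (at x within T)"
    and orth: "\<And>i j. qdot (a x i) (a x j) = (if i = j then 1 else 0)"
    and tangent: "\<And>i j z. z \<in> T \<Longrightarrow>
      qdot (b i (z - x)) (a x j) + qdot (a x i) (b j (z - x)) = 0"
  shows "((\<lambda>z. gram_schmidt (a z) j) has_derivative b j) (at x within T)"
proof (induction j rule: finite_linorder_induct)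
  case (less j)
  note fixes_a = gram_schmidt_fixes_orthonormal[of "a x", OF orth]
  have bl: "bounded_linear (b j)" for j
    using der by (rule has_derivative_bounded_linear)
  have unit: "norm (a x j) = 1" for j
    using arg_cong[OF orth[of j j], of q0] by (simp add: q0_qdot norm_eq_sqrt_inner)
  have "((\<lambda>z. residual (a z) j) has_derivative (\<lambda>h. b j h - (\<Sum>i\<in>{..<j}.
      rscale (a x i) (qdot (a x i) (b j h) + qdot (b i h) (a x j)) +
      rscale (b i h) (qdot (a x i) (a x j))))) (at x within T)"
    unfolding residual_def
    by (rule has_derivative_eq_rhs, (rule has_derivative_diff has_derivative_sum der less
        bounded_bilinear.FDERIV[OF bounded_bilinear_rscale]
        bounded_bilinear.FDERIV[OF bounded_bilinear_qdot] | simp)+)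
       (simp add: fixes_a)
  then have res: "((\<lambda>z. residual (a z) j) has_derivative b j) (at x within T)"
  proof (rule has_derivative_cong_within[OF _ bl])
    fix z assume z: "z \<in> T"
    then have "qdot (a x i) (b j (z - x)) + qdot (b i (z - x)) (a x j) = 0" for i
      using tangent[of z i j] by (simp add: add.commute)
    then show "b j (z - x) - (\<Sum>i\<in>{..<j}.
      rscale (a x i) (qdot (a x i) (b j (z - x)) + qdot (b i (z - x)) (a x j)) +
      rscale (b i (z - x)) (qdot (a x i) (a x j))) = b j (z - x)"
      by (subst sum.neutral) (auto simp: orth)
  qed
  have "((\<lambda>z. inverse (norm (residual (a z) j)) *\<^sub>R residual (a z) j) has_derivative
      (\<lambda>h. b j h - (a x j \<bullet> b j h) *\<^sub>R a x j)) (at x within T)"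
  proof (rule has_derivative_eq_rhs)
    have "residual (a x) j \<noteq> 0"
      using unit[of j] by (auto simp: fixes_a)
    then show "((\<lambda>z. inverse (norm (residual (a z) j)) *\<^sub>R residual (a z) j) has_derivative
       (\<lambda>h. inverse (norm (residual (a x) j)) *\<^sub>R b j h +
         (- (inverse (norm (residual (a x) j)) ^ 3 * (residual (a x) j \<bullet> b j h)))
           *\<^sub>R residual (a x) j)) (at x within T)"
      by (intro has_derivative_scaleR has_derivative_inverse_norm res)
  qed (simp add: fixes_a unit)
  then have "((\<lambda>z. gram_schmidt (a z) j) has_derivative
      (\<lambda>h. b j h - (a x j \<bullet> b j h) *\<^sub>R a x j)) (at x within T)"
    by (simp add: gram_schmidt_residual sgn_div_norm divide_inverse)
  then show ?case
  proof (rule has_derivative_cong_within[OF _ bl])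
    fix z assume z: "z \<in> T"
    have "a x j \<bullet> b j (z - x) = 0"
      using arg_cong[OF tangent[OF z, of j j], of q0] by (simp add: q0_qdot inner_commute)
    then show "b j (z - x) - (a x j \<bullet> b j (z - x)) *\<^sub>R a x j = b j (z - x)"
      by simp
  qed
qed

section \<open>The retraction\<close>

text \<open>
  Writing a matrix as a sum of such pieces reduces smoothness and differentiation of
  \<open>orthonormalize\<close> to its columns by linearity.
\<close>
definition column_matrix :: "'p \<Rightarrow> quat^'n \<Rightarrow> quat^'p^'n" where
  "column_matrix j v = (\<chi> i k. if k = j then v $ i else 0)"

lemma bounded_linear_column_matrix: "bounded_linear (column_matrix j :: quat^'n \<Rightarrow> quat^'p^'n)"
  unfolding linear_conv_bounded_linear[symmetric]
  by (rule linearI) (simp_all add: column_matrix_def vec_eq_iff)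

lemma matrix_sum_column_matrix: "(\<Sum>j\<in>UNIV. column_matrix j (column j A)) = A"
  by (simp add: vec_eq_iff column_matrix_def)

lemma orthonormalize_sum:
  "orthonormalize A = (\<Sum>j\<in>UNIV. column_matrix j (gram_schmidt (\<lambda>j. column j A) j))"
  using matrix_sum_column_matrix[of "orthonormalize A"] by (simp add: column_orthonormalize)

lemma bounded_linear_column: "bounded_linear (column j :: quat^'p^'n \<Rightarrow> quat^'n)"
  unfolding linear_conv_bounded_linear[symmetric]
  by (rule linearI) (simp_all add: vec_eq_iff)

lemma smooth_near_orthonormalize:
  fixes f :: "'z::euclidean_space \<Rightarrow> quat^('p::{finite,linorder})^'n"
  assumes smooth: "smooth_near f z" and rank: "\<And>x. f z *v x = 0 \<Longrightarrow> x = 0"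
  shows "smooth_near (\<lambda>z. orthonormalize (f z)) z"
proof -
  have "smooth_near (\<lambda>z. gram_schmidt (\<lambda>j. column j (f z)) j) z" for j
  proof (rule smooth_near_gram_schmidt)
    show "smooth_near (\<lambda>z. column j (f z)) z" for j
      by (rule smooth_near_linear_image[OF bounded_linear_column smooth])
    show "residual (\<lambda>j. column j (f z)) j \<noteq> 0" for j
      using rank by (rule residual_nonzero)
  qed
  then show ?thesis
    unfolding orthonormalize_sum
    by (intro smooth_near_sum smooth_near_linear_image[OF bounded_linear_column_matrix])
qed

lemma has_derivative_orthonormalize:
  fixes f :: "'z::real_normed_vector \<Rightarrow> quat^('p::{finite,linorder})^'n"
  assumes der: "(f has_derivative D) (at x within T)"
    and orth: "conj_transpose (f x) ** f x = mat 1"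
    and tangent: "\<And>z. z \<in> T \<Longrightarrow>
      conj_transpose (D (z - x)) ** f x + conj_transpose (f x) ** D (z - x) = 0"
  shows "((\<lambda>z. orthonormalize (f z)) has_derivative D) (at x within T)"
proof -
  have "((\<lambda>z. gram_schmidt (\<lambda>j. column j (f z)) j) has_derivative (\<lambda>h. column j (D h)))
      (at x within T)" for j
  proof (rule has_derivative_gram_schmidt)
    show "((\<lambda>z. column j (f z)) has_derivative (\<lambda>h. column j (D h))) (at x within T)" for j
      by (rule bounded_linear.has_derivative[OF bounded_linear_column der])
    show "qdot (column i (f x)) (column j (f x)) = (if i = j then 1 else 0)" for i j
      unfolding conj_transpose_mult_nth[symmetric] orth by (simp add: mat_def)
    show "qdot (column i (D (z - x))) (column j (f x)) +
        qdot (column i (f x)) (column j (D (z - x))) = 0" if "z \<in> T" for i j z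
      using arg_cong[OF tangent[OF that], of "\<lambda>M. M $ i $ j"]
      by (simp add: conj_transpose_mult_nth)
  qed
  then have "((\<lambda>z. orthonormalize (f z)) has_derivative
     (\<lambda>h. \<Sum>j\<in>UNIV. column_matrix j (column j (D h)))) (at x within T)"
    unfolding orthonormalize_sum
    by (intro has_derivative_sum bounded_linear.has_derivative[OF bounded_linear_column_matrix])
  then show ?thesis
    by (simp add: matrix_sum_column_matrix)
qed

theorem proposition7:
  fixes G :: "quat^'n^'n"
  assumes "CARD('p::{finite,linorder}) \<le> CARD('n)"
    and "hermitian_pos_def G"
  shows "manifold_retraction (stiefel G :: (quat^('p::{finite,linorder})^'n) set)
    (stiefel_tangent G) (qr_retraction G)"
proof -
  define S where "S = matrix_sqrt G"
  define T where "T = matrix_inv S"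
  have S: "hermitian_pos_def S" and SS: "S ** S = G"
    using matrix_sqrt[OF assms(2)] by (simp_all add: S_def)
  have hS: "conj_transpose S = S"
    using S by (simp add: hermitian_pos_def_iff)
  have ST: "S ** T = mat 1" and TS: "T ** S = mat 1"
    using matrix_inv_mult[OF hermitian_pos_def_invertible[OF S]] by (simp_all add: T_def)
  have gram: "conj_transpose (S ** A) ** (S ** B) = conj_transpose A ** G ** B"
    for A B :: "quat^('p::{finite,linorder})^'n"
    by (simp add: conj_transpose_mult hS matrix_mul_assoc flip: SS)
  have T_S: "T ** (S ** A) = A" and S_T: "S ** (T ** A) = A" for A :: "quat^('p::{finite,linorder})^'n"
    by (simp_all add: matrix_mul_assoc ST TS)

  \<comment> \<open>By tangency the mixed terms of the Gram matrix of \<open>S (X + \<eta>)\<close> cancel,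
  which leaves \<open>I + (S \<eta>)\<^sup>H (S \<eta>)\<close>.\<close>
  have full_rank: "x = 0"
    if X: "X \<in> stiefel G" and \<eta>: "\<eta> \<in> stiefel_tangent G X" and x: "(S ** (X + \<eta>)) *v x = 0"
    for X \<eta> :: "quat^('p::{finite,linorder})^'n" and x
  proof -
    let ?A = "S ** (X + \<eta>)"
    have "conj_transpose ?A ** ?A =
        conj_transpose X ** G ** X + (conj_transpose \<eta> ** G ** X + conj_transpose X ** G ** \<eta>)
        + conj_transpose (S ** \<eta>) ** (S ** \<eta>)"
      unfolding gram matrix_eq
      by (simp add: conj_transpose_add algebra_simps flip: matrix_vector_mul_assoc)
    also have "\<dots> = mat 1 + conj_transpose (S ** \<eta>) ** (S ** \<eta>)"
      using X \<eta> by (simp add: stiefel_def stiefel_tangent_def)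
    finally have "(mat 1 + conj_transpose (S ** \<eta>) ** (S ** \<eta>)) *v x = conj_transpose ?A *v (?A *v x)"
      by (simp add: matrix_vector_mul_assoc)
    then have "x + conj_transpose (S ** \<eta>) *v ((S ** \<eta>) *v x) = 0"
      by (simp add: x matrix_vector_mult_add_rdistrib matrix_vector_mul_assoc)
    then have "x \<bullet> x + x \<bullet> (conj_transpose (S ** \<eta>) *v ((S ** \<eta>) *v x)) = 0"
      by (metis inner_add_right inner_zero_right)
    then have "x \<bullet> x + ((S ** \<eta>) *v x) \<bullet> ((S ** \<eta>) *v x) = 0"
      by (simp add: inner_matrix_vector)
    then have "x \<bullet> x = 0"
      using inner_ge_zero[of x] inner_ge_zero[of "(S ** \<eta>) *v x"] by linarith
    then show ?thesis by simp
  qed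

  have retr: "qr_retraction G X \<eta> = T ** orthonormalize (S ** (X + \<eta>))"
    if "X \<in> stiefel G" "\<eta> \<in> stiefel_tangent G X" for X \<eta> :: "quat^('p::{finite,linorder})^'n"
    unfolding qr_retraction_def S_def[symmetric] T_def[symmetric]
    by (subst qf_eq_orthonormalize) (use full_rank[OF that] in auto)
  have zero: "0 \<in> stiefel_tangent G X" for X :: "quat^('p::{finite,linorder})^'n"
    by (simp add: stiefel_tangent_def vec_eq_iff matrix_matrix_mult_def)

  have into: "qr_retraction G X \<eta> \<in> stiefel G"
    if "X \<in> stiefel G" "\<eta> \<in> stiefel_tangent G X" for X \<eta> :: "quat^('p::{finite,linorder})^'n"
  proof -
    let ?Q = "orthonormalize (S ** (X + \<eta>))"
    note rank = full_rank[OF that]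
    obtain R where "is_qr (S ** (X + \<eta>)) ?Q R"
      using is_qr_exists[OF rank] by blast
    then have "conj_transpose ?Q ** ?Q = mat 1"
      by (simp add: is_qr_def)
    then have "conj_transpose (T ** ?Q) ** G ** (T ** ?Q) = mat 1"
      by (simp only: gram[symmetric] S_T)
    then show ?thesis
      by (simp add: retr[OF that] stiefel_def)
  qed

  have bl_S: "bounded_linear (\<lambda>A :: quat^('p::{finite,linorder})^'n. S ** A)" and bl_T: "bounded_linear (\<lambda>A :: quat^('p::{finite,linorder})^'n. T ** A)"
    using linear_matrix_mult_quat by (auto simp only: linear_conv_bounded_linear)

  have smooth: "smooth_map_on (Sigma (stiefel G) (stiefel_tangent G))
      (\<lambda>(X, \<eta> :: quat^('p::{finite,linorder})^'n). qr_retraction G X \<eta>)"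
  proof (rule smooth_map_on_eqI)
    fix z :: "(quat^('p::{finite,linorder})^'n) \<times> (quat^('p::{finite,linorder})^'n)"
    assume z: "z \<in> Sigma (stiefel G) (stiefel_tangent G)"
    have "bounded_linear (\<lambda>z :: (quat^('p::{finite,linorder})^'n) \<times> (quat^('p::{finite,linorder})^'n). S ** (fst z + snd z))"
      by (intro bounded_linear_compose[OF bl_S] bounded_linear_add bounded_linear_fst bounded_linear_snd)
    then show "smooth_near (\<lambda>z. T ** orthonormalize (S ** (fst z + snd z))) z"
    proof (intro smooth_near_linear_image[OF bl_T] smooth_near_orthonormalize
        smooth_near_bounded_linear)
      show "x = 0" if "(S ** (fst z + snd z)) *v x = 0" for x
        using full_rank[OF _ _ that] z by (auto simp: mem_Times_iff Sigma_def)
    qed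
    show "(case z of (X, \<eta>) \<Rightarrow> qr_retraction G X \<eta>) = T ** orthonormalize (S ** (fst z + snd z))"
      using z by (auto simp: retr)
  qed

  have centre: "qr_retraction G X 0 = X"
    and deriv: "(qr_retraction G X has_derivative (\<lambda>\<xi>. \<xi>)) (at 0 within stiefel_tangent G X)"
    if X: "X \<in> stiefel G" for X :: "quat^('p::{finite,linorder})^'n"
  proof -
    have orth: "conj_transpose (S ** X) ** (S ** X) = mat 1"
      using X unfolding gram by (simp add: stiefel_def)
    \<comment> \<open>The columns of \<open>S X\<close> are orthonormal already, so its QR decomposition is trivial.\<close>
    have "is_qr (S ** X) (S ** X) (mat 1)"
      unfolding is_qr_def
    proof (intro conjI allI impI)
      show "S ** X = S ** X ** mat 1"
        by simp
      show "mat 1 $ i $ j = (0 :: quat)" if "j < i" for i j :: 'p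
        using that by (simp add: mat_def)
      show "\<exists>r>0. mat 1 $ i $ i = (of_real r :: quat)" for i :: 'p
        by (intro exI[of _ 1]) (simp add: mat_def)
    qed (fact orth)
    then have "orthonormalize (S ** X) = S ** X"
      by (rule is_qr_unique[symmetric])
    then show "qr_retraction G X 0 = X"
      using retr[OF X zero] by (simp add: T_S)
    have "((\<lambda>\<eta>. orthonormalize (S ** (X + \<eta>))) has_derivative (\<lambda>\<xi>. S ** \<xi>))
        (at 0 within stiefel_tangent G X)"
    proof (rule has_derivative_orthonormalize)
      show "((\<lambda>\<eta>. S ** (X + \<eta>)) has_derivative (\<lambda>\<xi>. S ** \<xi>)) (at 0 within stiefel_tangent G X)"
        using has_derivative_add[OF has_derivative_const has_derivative_ident]
        by (intro bounded_linear.has_derivative[OF bl_S]) simp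
      show "conj_transpose (S ** (X + 0)) ** (S ** (X + 0)) = mat 1"
        using orth by simp
      show "conj_transpose (S ** (\<xi> - 0)) ** (S ** (X + 0)) +
          conj_transpose (S ** (X + 0)) ** (S ** (\<xi> - 0)) = 0" if "\<xi> \<in> stiefel_tangent G X" for \<xi>
        using that by (simp add: gram stiefel_tangent_def)
    qed
    from bounded_linear.has_derivative[OF bl_T this]
    have "((\<lambda>\<eta>. T ** orthonormalize (S ** (X + \<eta>))) has_derivative (\<lambda>\<xi>. \<xi>))
        (at 0 within stiefel_tangent G X)"
      by (simp add: T_S)
    then show "(qr_retraction G X has_derivative (\<lambda>\<xi>. \<xi>)) (at 0 within stiefel_tangent G X)"
      by (rule has_derivative_transform[OF zero, rotated]) (simp add: retr[OF X])
  qed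
  show ?thesis
    unfolding manifold_retraction_def using into smooth centre deriv by blast
qed

end
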